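(* Let $R>0$ and let $|z|\le R$. Then $N_z\in\mathfrak F_{dist}(\mathbf 2)$. More precisely, there is a $p\in\mathbb N$, independent of $z$ with $|z|\le R$, such that $N_z\in\mathcal F_{-p}$. Moreover, in the topology of $\mathfrak F_{dist}(\mathbf 2)$, $$\partial B_z=N_z,$$ that is, $\lim_{w\to z,\,w\ne z}\frac{B_w-B_z}{w-z}=N_z$ in $\mathfrak F_{dist}(\mathbf 2)$.
   Context: Hermite functions: $H_n(z)=(-1)^ne^{z^2}(d/dz)^ne^{-z^2}$ and $\zeta_n(z)=\frac{1}{\pi^{1/4}2^{n/2}(n!)^{1/2}}(-1)^ne^{-z^2/2}H_n(z)$, $n=0,1,\ldots$; these are entire functions, orthonormal in $L_2(\mathbb R,dx)$. For an entire function $h$, $\int_{[w,z]}h(u)\,du$ is the complex line integral along the segment from $w$ to $z$. White noise space: $\mathscr S'_{\mathbb R}$ is the space of real tempered distributions on $\mathbb R$, $\mathcal C$ its cylinder sigma-algebra, and $P$ the probability measure (Bochner–Minlos) with $\int e^{i\langle s,\omega\rangle}dP(\omega)=e^{-\|s\|_2^2/2}$ for all real Schwartz functions $s$. $Z_n(\omega)=\langle\zeta_n,\omega\rangle$, $n=0,1,\ldots$, are independent $N(0,1)$ random variables. Let $\ell$ be the set of finitely supported sequences $\alpha=(\alpha_1,\alpha_2,\ldots)$ of non-negative integers, with $\alpha!=\prod_k\alpha_k!$. The functions $H_\alpha=\prod_{k\ge1}h_{\alpha_k}(Z_{k-1})$, where $h_n(x)=(-1)^ne^{x^2/2}(d/dx)^ne^{-x^2/2}$,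 form an orthogonal basis of $\mathbf L_2(\mathscr S'_{\mathbb R},\mathcal C,P)$ with $\|H_\alpha\|^2=\alpha!$. Elements $\sum_\alpha f_\alpha H_\alpha$ are identified with their coefficient families $(f_\alpha)_{\alpha\in\ell}$; in particular $Z_n$ is identified with the family equal to $1$ at $\alpha^{(n)}$ and $0$ elsewhere, where $\alpha^{(n)}\in\ell$ has $1$ in position $n+1$ and $0$ elsewhere. Stochastic distributions: let $b_\alpha=\prod_{k\ge1}(2^k)^{\alpha_k}$. For $p=1,2,\ldots$, $\mathcal F_{-p}$ is the Hilbert space of complex families $(f_\alpha)_{\alpha\in\ell}$ with $\|f\|_{-p}^2=\sum_{\alpha\in\ell}|f_\alpha|^2b_\alpha^{-p}<\infty$, and $\mathfrak F_{dist}(\mathbf 2)=\bigcup_{p\ge1}\mathcal F_{-p}$ with the inductive limit topology. Complex Brownian motion: for $z\in\mathbb C$, $B_z=\sum_{n=0}^\infty\left(\int_{[0,z]}\zeta_n(u)\,du\right)Z_n$, i.e. the family with coefficient $\int_{[0,z]}\zeta_n(u)du$ at $\alpha^{(n)}$ ($n\ge0$) and $0$ at all other $\alpha\in\ell$. Complex white noise: $N_z=\sum_{n=0}^\infty\zeta_n(z)Z_n$, i.e. the family with coefficient $\zeta_n(z)$ at $\alpha^{(n)}$ and $0$ at all other $\alpha\in\ell$. *)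

theory Defs
  imports "HOL-Complex_Analysis.Complex_Analysis" "HOL-Library.Poly_Mapping"
begin

section \<open>Hermite functions\<close>

definition hermite_H :: "nat \<Rightarrow> complex \<Rightarrow> complex" where
  "hermite_H n z = (-1) ^ n * exp (z\<^sup>2) * (deriv ^^ n) (\<lambda>u. exp (- u\<^sup>2)) z"

definition hermite_zeta :: "nat \<Rightarrow> complex \<Rightarrow> complex" where
  "hermite_zeta n z =
     1 / complex_of_real (pi powr (1 / 4) * 2 powr (real n / 2) * sqrt (fact n))
       * (-1) ^ n * exp (- (z\<^sup>2) / 2) * hermite_H n z"


section \<open>Stochastic distributions\<close>

text \<open>
  The multi-index \<open>(\<alpha>\<^sub>1, \<alpha>\<^sub>2, \<dots>)\<close> is represented with positions shifted down by one:
  \<open>\<alpha>\<^sub>k\<close> is \<open>lookup \<alpha> (k - 1)\<close>.  A formal series \<open>\<Sum>\<^sub>\<alpha> f\<^sub>\<alpha> H\<^sub>\<alpha>\<close> is identified with its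
  coefficient family \<open>f\<close>.
\<close>

type_synonym multi_index = "nat \<Rightarrow>\<^sub>0 nat"
type_synonym family = "multi_index \<Rightarrow> complex"

definition weight :: "multi_index \<Rightarrow> real" where
  "weight \<alpha> = (\<Prod>k\<in>Poly_Mapping.keys \<alpha>. (2 ^ Suc k) ^ Poly_Mapping.lookup \<alpha> k)"

definition Fneg :: "nat \<Rightarrow> family set" where
  "Fneg p = {f. (\<lambda>\<alpha>. (cmod (f \<alpha>))\<^sup>2 / weight \<alpha> ^ p) summable_on UNIV}"

definition norm_neg :: "nat \<Rightarrow> family \<Rightarrow> real" where
  "norm_neg p f = sqrt (\<Sum>\<^sub>\<infinity>\<alpha>. (cmod (f \<alpha>))\<^sup>2 / weight \<alpha> ^ p)"

definition Fdist :: "family set" where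
  "Fdist = (\<Union>p\<in>{1..}. Fneg p)"

definition absolutely_convex :: "family set \<Rightarrow> bool" where
  "absolutely_convex V \<longleftrightarrow>
     (\<forall>f\<in>V. \<forall>g\<in>V. \<forall>a b. cmod a + cmod b \<le> 1 \<longrightarrow> (\<lambda>\<alpha>. a * f \<alpha> + b * g \<alpha>) \<in> V)"

text \<open>
  The inductive limit is taken in the category of locally convex spaces: a base of
  neighbourhoods of \<open>0\<close> consists of the absolutely convex sets whose intersection with each
  Hilbert space \<open>Fneg p\<close>, \<open>p \<ge> 1\<close>, is a neighbourhood of \<open>0\<close> there.
\<close>

definition Fdist_nhd0 :: "family set \<Rightarrow> bool" where
  "Fdist_nhd0 V \<longleftrightarrow> V \<subseteq> Fdist \<and> absolutely_convex V \<and>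
     (\<forall>p\<ge>1. \<exists>\<epsilon>>0. {f \<in> Fneg p. norm_neg p f < \<epsilon>} \<subseteq> V)"

definition Fdist_open :: "family set \<Rightarrow> bool" where
  "Fdist_open U \<longleftrightarrow> U \<subseteq> Fdist \<and>
     (\<forall>f\<in>U. \<exists>V. Fdist_nhd0 V \<and> (\<forall>g\<in>V. (\<lambda>\<alpha>. f \<alpha> + g \<alpha>) \<in> U))"

definition Fdist_topology :: "family topology" where
  "Fdist_topology = topology Fdist_open"

lemma Fdist_nhd0_Int:
  assumes "Fdist_nhd0 V" "Fdist_nhd0 W"
  shows "Fdist_nhd0 (V \<inter> W)"
proof -
  have "\<exists>\<epsilon>>0. {f \<in> Fneg p. norm_neg p f < \<epsilon>} \<subseteq> V \<inter> W" if "p \<ge> 1" for p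
  proof -
    obtain d e where "d > 0" "{f \<in> Fneg p. norm_neg p f < d} \<subseteq> V"
      "e > 0" "{f \<in> Fneg p. norm_neg p f < e} \<subseteq> W"
      using assms \<open>p \<ge> 1\<close> unfolding Fdist_nhd0_def by meson
    then show ?thesis
      by (intro exI[of _ "min d e"]) auto
  qed
  then show ?thesis
    using assms unfolding Fdist_nhd0_def absolutely_convex_def by auto
qed

lemma istopology_Fdist_open: "istopology Fdist_open"
  unfolding istopology_def
proof (intro conjI allI impI)
  fix S T assume S: "Fdist_open S" and T: "Fdist_open T"
  show "Fdist_open (S \<inter> T)"
    unfolding Fdist_open_def
  proof (intro conjI ballI)
    show "S \<inter> T \<subseteq> Fdist"
      using S unfolding Fdist_open_def by blast
    fix f assume f: "f \<in> S \<inter> T"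
    obtain V where V: "Fdist_nhd0 V" "\<forall>g\<in>V. (\<lambda>\<alpha>. f \<alpha> + g \<alpha>) \<in> S"
      using S f unfolding Fdist_open_def by blast
    obtain W where W: "Fdist_nhd0 W" "\<forall>g\<in>W. (\<lambda>\<alpha>. f \<alpha> + g \<alpha>) \<in> T"
      using T f unfolding Fdist_open_def by blast
    show "\<exists>V. Fdist_nhd0 V \<and> (\<forall>g\<in>V. (\<lambda>\<alpha>. f \<alpha> + g \<alpha>) \<in> S \<inter> T)"
      using V W Fdist_nhd0_Int by (intro exI[of _ "V \<inter> W"]) blast
  qed
next
  fix K assume K: "\<forall>U\<in>K. Fdist_open U"
  show "Fdist_open (\<Union>K)"
    unfolding Fdist_open_def
  proof (intro conjI ballI)
    show "\<Union>K \<subseteq> Fdist"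
      using K unfolding Fdist_open_def by blast
    fix f assume "f \<in> \<Union>K"
    then obtain U where U: "U \<in> K" "f \<in> U" by blast
    then obtain V where "Fdist_nhd0 V" "\<forall>g\<in>V. (\<lambda>\<alpha>. f \<alpha> + g \<alpha>) \<in> U"
      using K unfolding Fdist_open_def by blast
    then show "\<exists>V. Fdist_nhd0 V \<and> (\<forall>g\<in>V. (\<lambda>\<alpha>. f \<alpha> + g \<alpha>) \<in> \<Union>K)"
      using U by blast
  qed
qed

lemma openin_Fdist_topology: "openin Fdist_topology = Fdist_open"
  unfolding Fdist_topology_def using istopology_Fdist_open by (rule topology_inverse')

lemma weight_ge_1: "weight \<alpha> \<ge> 1"
  unfolding weight_def by (intro prod_ge_1 one_le_power) simp

lemma Fneg_mono:
  assumes "p \<le> q"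
  shows "Fneg p \<subseteq> Fneg q"
proof
  fix f assume "f \<in> Fneg p"
  then have sm: "(\<lambda>\<alpha>. (cmod (f \<alpha>))\<^sup>2 / weight \<alpha> ^ p) summable_on UNIV"
    by (simp add: Fneg_def)
  have le: "(cmod (f \<alpha>))\<^sup>2 / weight \<alpha> ^ q \<le> (cmod (f \<alpha>))\<^sup>2 / weight \<alpha> ^ p" for \<alpha>
    using power_increasing[OF assms weight_ge_1[of \<alpha>]] weight_ge_1[of \<alpha>]
    by (intro divide_left_mono mult_pos_pos zero_less_power) auto
  have nn: "0 \<le> (cmod (f \<alpha>))\<^sup>2 / weight \<alpha> ^ q" for \<alpha>
    using weight_ge_1[of \<alpha>] by (intro divide_nonneg_nonneg zero_le_power) auto
  from sm le nn have "(\<lambda>\<alpha>. (cmod (f \<alpha>))\<^sup>2 / weight \<alpha> ^ q) summable_on UNIV"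
    by (rule summable_on_comparison_test)
  then show "f \<in> Fneg q"
    by (simp add: Fneg_def)
qed

lemma Fneg_lincomb:
  assumes "f \<in> Fneg p" "g \<in> Fneg p"
  shows "(\<lambda>\<alpha>. a * f \<alpha> + b * g \<alpha>) \<in> Fneg p"
proof -
  let ?m = "\<lambda>\<alpha>. 2 * (cmod a)\<^sup>2 * ((cmod (f \<alpha>))\<^sup>2 / weight \<alpha> ^ p)
              + 2 * (cmod b)\<^sup>2 * ((cmod (g \<alpha>))\<^sup>2 / weight \<alpha> ^ p)"
  have sm: "?m summable_on UNIV"
    using assms unfolding Fneg_def by (intro summable_on_add summable_on_cmult_right) auto
  have le: "(cmod (a * f \<alpha> + b * g \<alpha>))\<^sup>2 / weight \<alpha> ^ p \<le> ?m \<alpha>" for \<alpha>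
  proof -
    have "(cmod (a * f \<alpha> + b * g \<alpha>))\<^sup>2 \<le> (cmod (a * f \<alpha>) + cmod (b * g \<alpha>))\<^sup>2"
      by (intro power_mono norm_triangle_ineq) auto
    also have "\<dots> \<le> 2 * (cmod (a * f \<alpha>))\<^sup>2 + 2 * (cmod (b * g \<alpha>))\<^sup>2"
      using sum_squares_bound[of "cmod (a * f \<alpha>)" "cmod (b * g \<alpha>)"]
      by (simp add: power2_sum)
    finally have "(cmod (a * f \<alpha> + b * g \<alpha>))\<^sup>2 / weight \<alpha> ^ p
        \<le> (2 * (cmod (a * f \<alpha>))\<^sup>2 + 2 * (cmod (b * g \<alpha>))\<^sup>2) / weight \<alpha> ^ p"
      using weight_ge_1[of \<alpha>] by (intro divide_right_mono zero_le_power) auto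
    also have "\<dots> = ?m \<alpha>"
      by (simp add: norm_mult power_mult_distrib add_divide_distrib)
    finally show ?thesis .
  qed
  have nn: "0 \<le> (cmod (a * f \<alpha> + b * g \<alpha>))\<^sup>2 / weight \<alpha> ^ p" for \<alpha>
    using weight_ge_1[of \<alpha>] by (intro divide_nonneg_nonneg zero_le_power) auto
  show ?thesis
    unfolding Fneg_def using summable_on_comparison_test[OF sm le nn] by simp
qed

lemma Fdist_lincomb:
  assumes "f \<in> Fdist" "g \<in> Fdist"
  shows "(\<lambda>\<alpha>. a * f \<alpha> + b * g \<alpha>) \<in> Fdist"
proof -
  obtain p q where pq: "p \<ge> 1" "f \<in> Fneg p" "q \<ge> 1" "g \<in> Fneg q"
    using assms unfolding Fdist_def by auto
  then have "f \<in> Fneg (max p q)" "g \<in> Fneg (max p q)"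
    using Fneg_mono[of p "max p q"] Fneg_mono[of q "max p q"] by auto
  then have "(\<lambda>\<alpha>. a * f \<alpha> + b * g \<alpha>) \<in> Fneg (max p q)"
    by (rule Fneg_lincomb)
  then show ?thesis
    unfolding Fdist_def using pq(1) by (intro UN_I[of "max p q"]) auto
qed

lemma topspace_Fdist_topology: "topspace Fdist_topology = Fdist"
proof -
  have "Fdist_nhd0 Fdist"
    unfolding Fdist_nhd0_def absolutely_convex_def
  proof (intro conjI ballI allI impI)
    show "\<exists>\<epsilon>>0. {f \<in> Fneg p. norm_neg p f < \<epsilon>} \<subseteq> Fdist" if "p \<ge> 1" for p
      using that by (intro exI[of _ 1]) (auto simp: Fdist_def)
  qed (simp_all add: Fdist_lincomb)
  moreover have "(\<lambda>\<alpha>. f \<alpha> + g \<alpha>) \<in> Fdist" if "f \<in> Fdist" "g \<in> Fdist" for f g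
    using Fdist_lincomb[OF that, of 1 1] by simp
  ultimately have "openin Fdist_topology Fdist"
    unfolding openin_Fdist_topology Fdist_open_def by blast
  moreover have "U \<subseteq> Fdist" if "openin Fdist_topology U" for U
    using that unfolding openin_Fdist_topology Fdist_open_def by blast
  ultimately show ?thesis
    by (intro subset_antisym openin_subset) auto
qed


section \<open>Complex Brownian motion and complex white noise\<close>

definition unit_index :: "nat \<Rightarrow> multi_index" where
  "unit_index n = Poly_Mapping.single n 1"

text \<open>
  \<open>first_chaos c\<close> is the coefficient family of \<open>\<Sum>\<^sub>n c\<^sub>n Z\<^sub>n\<close>.  The \<open>THE\<close> is well defined because
  \<open>unit_index\<close> is injective.
\<close>

definition first_chaos :: "(nat \<Rightarrow> complex) \<Rightarrow> family" where
  "first_chaos c \<alpha> = (if \<alpha> \<in> range unit_index then c (THE n. \<alpha> = unit_index n) else 0)"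

lemma first_chaos_unit_index [simp]: "first_chaos c (unit_index n) = c n"
proof -
  have "unit_index n = unit_index m \<longleftrightarrow> n = m" for m
    unfolding unit_index_def by (metis lookup_single_eq lookup_single_not_eq zero_neq_one)
  then show ?thesis
    unfolding first_chaos_def by simp
qed

definition cBrownian :: "complex \<Rightarrow> family" where
  "cBrownian z = first_chaos (\<lambda>n. contour_integral (linepath 0 z) (hermite_zeta n))"

definition cWhite_noise :: "complex \<Rightarrow> family" where
  "cWhite_noise z = first_chaos (\<lambda>n. hermite_zeta n z)"

end

theory Submission
  imports Defs
begin

text \<open>
  Cauchy's inequality for \<open>exp (- u\<^sup>2)\<close> on the circle of radius \<open>sqrt (n + 1)\<close> around \<open>z\<close> shows
  that \<open>\<zeta>\<^sub>n\<close> grows at most like \<open>9\<^sup>n\<close>, locally uniformly; since \<open>9\<^sup>2 < 2\<^sup>7\<close>, families of the first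
  chaos with such coefficients lie in \<open>Fneg 7\<close>.  By Cauchy's inequality the derivatives \<open>\<zeta>\<^sub>n'\<close>
  obey the same bound, so the difference quotient of \<open>cBrownian\<close> differs from \<open>cWhite_noise z\<close> by
  \<open>O(\<bar>w - z\<bar>)\<close> in \<open>Fneg 7\<close>, and every neighbourhood of \<open>0\<close> in the inductive limit contains a
  ball of \<open>Fneg 7\<close>.
\<close>

section \<open>First-chaos families in the weighted Hilbert spaces\<close>

lemma weight_unit_index: "weight (unit_index n) = 2 ^ Suc n"
  by (simp add: weight_def unit_index_def)

lemma inj_unit_index: "inj unit_index"
  unfolding unit_index_def by (rule injI) (metis lookup_single_eq lookup_single_not_eq zero_neq_one)

lemma first_chaos_diff_quotient:
  "(\<lambda>\<alpha>. (first_chaos c \<alpha> - first_chaos d \<alpha>) / h) = first_chaos (\<lambda>n. (c n - d n) / h)"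
  by (auto simp: first_chaos_def)

lemma first_chaos_diff:
  "first_chaos (\<lambda>n. c n - d n) \<alpha> = first_chaos c \<alpha> - first_chaos d \<alpha>"
  by (auto simp: first_chaos_def)

text \<open>Only the indices \<open>unit_index n\<close>, of weight 2^(n+1), contribute, so the
  squared norm is dominated by a geometric series of ratio 81/128.\<close>

lemma first_chaos_Fneg_bound:
  assumes "\<And>n. cmod (c n) \<le> K * 9 ^ n"
  shows "first_chaos c \<in> Fneg 7" and "norm_neg 7 (first_chaos c) \<le> K"
proof -
  let ?g = "\<lambda>n. (cmod (c n))\<^sup>2 / (2 ^ Suc n) ^ 7"
  let ?f = "\<lambda>\<alpha>. (cmod (first_chaos c \<alpha>))\<^sup>2 / weight \<alpha> ^ 7"
  have K: "K \<ge> 0"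
    using order_trans[OF norm_ge_zero assms[of 0]] by simp
  have le: "?g n \<le> K\<^sup>2 / 128 * (81 / 128) ^ n" for n
  proof -
    have "(cmod (c n))\<^sup>2 \<le> (K * 9 ^ n)\<^sup>2"
      by (intro power_mono assms norm_ge_zero)
    also have "\<dots> = K\<^sup>2 * 81 ^ n"
      by (simp add: power2_eq_square flip: power_mult_distrib)
    finally have "?g n \<le> K\<^sup>2 * 81 ^ n / (2 ^ Suc n) ^ 7"
      by (intro divide_right_mono) auto
    moreover have "(2 ^ Suc n) ^ 7 = (128 * 128 ^ n :: real)"
      by (simp add: power_mult_distrib flip: power_mult) (simp add: mult.commute[of n] power_mult)
    ultimately show ?thesis
      by (simp only: power_divide times_divide_times_eq)
  qed
  have geo: "(\<lambda>n. K\<^sup>2 / 128 * (81 / 128) ^ n) sums (K\<^sup>2 / 128 * (1 / (1 - 81 / 128)))"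
    by (intro sums_mult geometric_sums) auto
  \<comment> \<open>47 = 128 - 81; the factor 1/47 is afterwards just bounded by 1.\<close>
  have geo': "((\<lambda>n. K\<^sup>2 / 128 * (81 / 128) ^ n) has_sum (K\<^sup>2 / 47)) UNIV"
    using sums_nonneg_imp_has_sum[OF geo] by simp
  have g: "?g summable_on UNIV"
    by (rule summable_on_comparison_test[OF has_sum_imp_summable[OF geo']]) (use le in auto)
  have "infsum ?g UNIV \<le> K\<^sup>2 / 47"
    using has_sum_mono[OF has_sum_infsum[OF g] geo'] le by auto
  also have "\<dots> \<le> K\<^sup>2"
    by simp
  finally have sum_le: "infsum ?g UNIV \<le> K\<^sup>2" .
  have comp: "?f \<circ> unit_index = ?g"
    by (simp add: fun_eq_iff weight_unit_index)
  have "(?f has_sum infsum ?g UNIV) (range unit_index)"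
    using has_sum_reindex[OF inj_unit_index, of ?f] has_sum_infsum[OF g] by (simp only: comp)
  \<comment> \<open>A first-chaos family vanishes off \<open>range unit_index\<close>, so the sum
    extends to all multi-indices.\<close>
  also have "(?f has_sum infsum ?g UNIV) (range unit_index) \<longleftrightarrow> (?f has_sum infsum ?g UNIV) UNIV"
    by (rule has_sum_cong_neutral) (auto simp: first_chaos_def)
  finally have hs: "(?f has_sum infsum ?g UNIV) UNIV" .
  show "first_chaos c \<in> Fneg 7"
    using hs unfolding Fneg_def by (blast intro: has_sum_imp_summable)
  have "norm_neg 7 (first_chaos c) = sqrt (infsum ?g UNIV)"
    using infsumI[OF hs] unfolding norm_neg_def by simp
  also have "\<dots> \<le> sqrt (K\<^sup>2)"
    using sum_le by (rule real_sqrt_le_mono)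
  finally show "norm_neg 7 (first_chaos c) \<le> K"
    using K by simp
qed

section \<open>Growth of the Hermite functions and their derivatives\<close>

lemma hermite_zeta_holomorphic: "hermite_zeta n holomorphic_on S"
proof -
  have "hermite_zeta n holomorphic_on UNIV"
    unfolding hermite_zeta_def[abs_def] hermite_H_def by (intro holomorphic_intros) auto
  then show ?thesis
    by (rule holomorphic_on_subset) simp
qed

lemma norm_exp_le_exp_norm:
  fixes z :: complex
  assumes "cmod z \<le> r"
  shows "cmod (exp z) \<le> exp r"
  using norm_exp[of z] assms by (meson exp_le_cancel_iff order_trans)

text \<open>Cauchy's factor n!/r^n meets the normalisation 1/sqrt(n!), leaving sqrt(n!)/r^n \<le> 1;
  the growth in n comes only from the maximum of \<open>exp (- u\<^sup>2)\<close> on the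
  circle.\<close>

lemma norm_hermite_zeta_le:
  assumes "cmod z \<le> R"
  shows "cmod (hermite_zeta n z) \<le> exp (4 * R\<^sup>2 + 2) * 9 ^ n"
proof -
  \<comment> \<open>This radius is positive even for n = 0 and satisfies r^(2n) \<ge> n!, while r^2
    costs only a factor exp(2n + 2) on the circle.\<close>
  define r where "r = sqrt (real n + 1)"
  define s where "s = sqrt (fact n :: real)"
  have r: "r > 0" "r\<^sup>2 = real n + 1"
    by (simp_all add: r_def)
  have s: "s > 0" "s\<^sup>2 = fact n"
    by (simp_all add: s_def)
  have z2: "cmod (z\<^sup>2) \<le> R\<^sup>2"
    using assms by (simp add: norm_power power_mono)
  have circle: "cmod (exp (- u\<^sup>2)) \<le> exp (2 * R\<^sup>2 + 2 * (n + 1))" if "cmod (z - u) = r" for u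
  proof -
    have "cmod u \<le> R + r"
      using norm_triangle_ineq4[of z "z - u"] assms that by simp
    then have "(cmod u)\<^sup>2 \<le> (R + r)\<^sup>2"
      by (intro power_mono) auto
    also have "\<dots> \<le> 2 * R\<^sup>2 + 2 * r\<^sup>2"
      using sum_squares_bound[of R r] by (simp add: power2_sum)
    finally show ?thesis
      by (intro norm_exp_le_exp_norm) (simp add: norm_power r)
  qed
  have D: "cmod ((deriv ^^ n) (\<lambda>u. exp (- u\<^sup>2)) z)
      \<le> s\<^sup>2 * exp (2 * R\<^sup>2 + 2 * (n + 1)) / r ^ n"
    unfolding s(2) using circle r(1)
    by (intro Cauchy_inequality) (auto intro!: holomorphic_intros continuous_intros)
  have "s\<^sup>2 \<le> (r ^ n)\<^sup>2"
  proof -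
    have "s\<^sup>2 \<le> real n ^ n"
      using fact_le_power[of n, where 'a = real] by (simp add: s)
    also have "\<dots> \<le> (r\<^sup>2) ^ n"
      unfolding r by (intro power_mono) auto
    finally show ?thesis
      by (simp add: mult.commute flip: power_mult)
  qed
  then have sr: "s \<le> r ^ n"
    by (rule power2_le_imp_le) (use r in simp)
  have den: "s \<le> pi powr (1 / 4) * 2 powr (real n / 2) * s"
  proof -
    have "1 \<le> pi powr (1 / 4)" "1 \<le> 2 powr (real n / 2)"
      using pi_gt3 by (auto intro!: ge_one_powr_ge_zero)
    then have "1 * 1 \<le> pi powr (1 / 4) * 2 powr (real n / 2)"
      by (intro mult_mono) auto
    then show ?thesis
      using s(1) by simp
  qed
  have "cmod (hermite_zeta n z) = 1 / (pi powr (1 / 4) * 2 powr (real n / 2) * s)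
      * (cmod (exp (- (z\<^sup>2) / 2)) * (cmod (exp (z\<^sup>2))
      * cmod ((deriv ^^ n) (\<lambda>u. exp (- u\<^sup>2)) z)))"
    using s(1) unfolding hermite_zeta_def hermite_H_def s_def[symmetric]
    by (simp add: norm_mult norm_divide norm_power del: norm_exp_eq_Re)
  also have "\<dots> \<le> 1 / s * (exp (R\<^sup>2 / 2) * (exp (R\<^sup>2)
      * (s\<^sup>2 * exp (2 * R\<^sup>2 + 2 * (n + 1)) / r ^ n)))"
    using den s(1) r(1) z2 D
    by (intro mult_mono frac_le norm_exp_le_exp_norm) auto
  also have "\<dots> = (s / r ^ n) * (exp (R\<^sup>2 / 2) * exp (R\<^sup>2) * exp (2 * R\<^sup>2 + 2 * (n + 1)))"
    using s(1) r(1) by (simp add: field_simps power2_eq_square)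
  also have "\<dots> \<le> 1 * (exp (R\<^sup>2 / 2) * exp (R\<^sup>2) * exp (2 * R\<^sup>2 + 2 * (n + 1)))"
    using sr r(1) by (intro mult_right_mono) auto
  also have "\<dots> = exp (R\<^sup>2 / 2 + R\<^sup>2 + (2 * R\<^sup>2 + 2 * (n + 1)))"
    by (simp only: exp_add mult.assoc)
  \<comment> \<open>The coefficients of R^2 add up to 7/2, rounded up to 4. The remaining exp(2n)
    becomes 9^n through e \<le> 3.\<close>
  also have "\<dots> \<le> exp (4 * R\<^sup>2 + 2 + real n * 2)"
    by (simp add: field_simps)
  also have "\<dots> = exp (4 * R\<^sup>2 + 2) * (exp 1 ^ 2) ^ n"
    by (simp add: exp_add exp_of_nat_mult flip: exp_of_nat2_mult power_mult)
  also have "\<dots> \<le> exp (4 * R\<^sup>2 + 2) * (3 ^ 2) ^ n"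
    by (intro mult_left_mono power_mono exp_le) auto
  finally show ?thesis
    by simp
qed

text \<open>Cauchy's inequality on the unit circle around z, which stays in the disc of radius R +
  1.\<close>

lemma norm_deriv_hermite_zeta_le:
  assumes "cmod z \<le> R"
  shows "cmod (deriv (hermite_zeta n) z) \<le> exp (4 * (R + 1)\<^sup>2 + 2) * 9 ^ n"
proof -
  have "cmod ((deriv ^^ 1) (hermite_zeta n) z) \<le> fact 1 * (exp (4 * (R + 1)\<^sup>2 + 2) * 9 ^ n) / 1 ^ 1"
  proof (rule Cauchy_inequality)
    show "cmod (hermite_zeta n x) \<le> exp (4 * (R + 1)\<^sup>2 + 2) * 9 ^ n" if "cmod (z - x) = 1" for x
      using norm_triangle_ineq4[of z "z - x"] assms that by (intro norm_hermite_zeta_le) simp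
  qed (auto intro: hermite_zeta_holomorphic holomorphic_on_imp_continuous_on)
  then show ?thesis
    by simp
qed

section \<open>Difference quotients of line integrals\<close>

text \<open>A global primitive g turns the integrals into increments of g; the mean value inequality
  is then applied twice, to f and to \<open>g u - u * f z\<close>.\<close>

lemma norm_diff_quotient_linepath_integral_le:
  fixes f :: "complex \<Rightarrow> complex"
  assumes f: "f holomorphic_on UNIV"
    and L: "\<And>u. u \<in> closed_segment z w \<Longrightarrow> cmod (deriv f u) \<le> L"
    and "w \<noteq> z"
  shows "cmod ((contour_integral (linepath 0 w) f - contour_integral (linepath 0 z) f) / (w - z) - f z)
    \<le> L * cmod (w - z)"
proof -
  obtain g where g: "\<And>x. (g has_field_derivative f x) (at x)"
    using holomorphic_convex_primitive'[OF convex_UNIV open_UNIV f] by auto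
  have int: "contour_integral (linepath 0 x) f = g x - g 0" for x
    using contour_integral_unique[OF contour_integral_primitive[of UNIV g f "linepath 0 x"]] g by simp
  have L0: "L \<ge> 0"
    using order_trans[OF norm_ge_zero L[of z]] by simp
  have lip: "cmod (f u - f z) \<le> L * cmod (w - z)" if u: "u \<in> closed_segment z w" for u
  proof -
    have "cmod (f u - f z) \<le> L * cmod (u - z)"
    proof (rule field_differentiable_bound[of "closed_segment z w"])
      show "(f has_field_derivative deriv f x) (at x within closed_segment z w)" for x
        using holomorphic_derivI[OF f] by (auto intro: DERIV_subset)
    qed (use L u in auto)
    also have "\<dots> \<le> L * cmod (w - z)"
      using segment_bound1[OF u] L0 by (intro mult_left_mono) auto
    finally show ?thesis .
  qed
  \<comment> \<open>The derivative \<open>f u - f z\<close> is already O(|w - z|) on the segment, so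
    the increment is of second order and one factor survives division by w - z.\<close>
  have "cmod ((g w - w * f z) - (g z - z * f z)) \<le> (L * cmod (w - z)) * cmod (w - z)"
  proof (rule field_differentiable_bound[of "closed_segment z w" "\<lambda>u. g u - u * f z" "\<lambda>u. f u - f z"])
    show "((\<lambda>u. g u - u * f z) has_field_derivative f x - f z) (at x within closed_segment z w)" for x
      by (auto intro!: derivative_eq_intros DERIV_subset[OF g])
  qed (use lip in auto)
  moreover have "(g w - g 0 - (g z - g 0)) / (w - z) - f z
      = ((g w - w * f z) - (g z - z * f z)) / (w - z)"
    using \<open>w \<noteq> z\<close> by (simp add: field_simps)
  ultimately show ?thesis
    using \<open>w \<noteq> z\<close> by (simp add: int norm_divide field_simps)
qed

text \<open>The radius is taken to be |z| itself: z affects only the constant, not the base 9, so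
  the exponent 7 serves all z.\<close>

lemma cWhite_noise_Fneg: "cWhite_noise z \<in> Fneg 7"
  unfolding cWhite_noise_def by (rule first_chaos_Fneg_bound) (rule norm_hermite_zeta_le[OF order_refl])

text \<open>Each coefficient of the error carries the same factor |w - z|, which therefore passes
  into the constant of the first-chaos estimate.\<close>

lemma cBrownian_diff_quotient_bound:
  assumes "w \<noteq> z" "cmod z \<le> R" "cmod w \<le> R"
  defines "E \<equiv> \<lambda>\<alpha>. (cBrownian w \<alpha> - cBrownian z \<alpha>) / (w - z) - cWhite_noise z \<alpha>"
  shows "E \<in> Fneg 7" and "norm_neg 7 E \<le> exp (4 * (R + 1)\<^sup>2 + 2) * cmod (w - z)"
proof -
  define c where "c n = (contour_integral (linepath 0 w) (hermite_zeta n)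
      - contour_integral (linepath 0 z) (hermite_zeta n)) / (w - z) - hermite_zeta n z" for n
  have E: "E = first_chaos c"
    unfolding E_def c_def[abs_def] cBrownian_def cWhite_noise_def
    by (simp add: fun_eq_iff first_chaos_diff first_chaos_diff_quotient[THEN fun_cong])
  have "cmod (c n) \<le> exp (4 * (R + 1)\<^sup>2 + 2) * 9 ^ n * cmod (w - z)" for n
    unfolding c_def
  proof (rule norm_diff_quotient_linepath_integral_le)
    fix u assume "u \<in> closed_segment z w"
    moreover have "closed_segment z w \<subseteq> cball 0 R"
      using assms by (intro closed_segment_subset) auto
    ultimately have "cmod u \<le> R"
      by auto
    then show "cmod (deriv (hermite_zeta n) u) \<le> exp (4 * (R + 1)\<^sup>2 + 2) * 9 ^ n"
      by (rule norm_deriv_hermite_zeta_le)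
  qed (use assms hermite_zeta_holomorphic in auto)
  then have c: "cmod (c n) \<le> exp (4 * (R + 1)\<^sup>2 + 2) * cmod (w - z) * 9 ^ n" for n
    by (simp add: mult_ac)
  show "E \<in> Fneg 7" and "norm_neg 7 E \<le> exp (4 * (R + 1)\<^sup>2 + 2) * cmod (w - z)"
    unfolding E using first_chaos_Fneg_bound[OF c] by auto
qed

section \<open>Convergence in the inductive limit\<close>

lemma limitin_Fdist_topologyI:
  assumes p: "p \<ge> 1" and f: "f \<in> Fneg p"
    and mem: "eventually (\<lambda>x. (\<lambda>\<alpha>. h x \<alpha> - f \<alpha>) \<in> Fneg p) F"
    and lim: "((\<lambda>x. norm_neg p (\<lambda>\<alpha>. h x \<alpha> - f \<alpha>)) \<longlongrightarrow> 0) F"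
  shows "limitin Fdist_topology h f F"
  unfolding limitin_def
proof (intro conjI allI impI)
  show "f \<in> topspace Fdist_topology"
    using p f by (auto simp: topspace_Fdist_topology Fdist_def)
  fix U assume "openin Fdist_topology U \<and> f \<in> U"
  then obtain V where V: "Fdist_nhd0 V" "\<forall>g\<in>V. (\<lambda>\<alpha>. f \<alpha> + g \<alpha>) \<in> U"
    unfolding openin_Fdist_topology Fdist_open_def by blast
  then obtain e where e: "e > 0" "{g \<in> Fneg p. norm_neg p g < e} \<subseteq> V"
    using p unfolding Fdist_nhd0_def by blast
  show "eventually (\<lambda>x. h x \<in> U) F"
    using mem order_tendstoD(2)[OF lim e(1)]
  proof eventually_elim
    case (elim x)
    then have "(\<lambda>\<alpha>. h x \<alpha> - f \<alpha>) \<in> V"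
      using e by blast
    then show ?case
      using V(2) by force
  qed
qed

lemma cBrownian_has_derivative:
  "limitin Fdist_topology (\<lambda>w \<alpha>. (cBrownian w \<alpha> - cBrownian z \<alpha>) / (w - z)) (cWhite_noise z) (at z)"
proof (rule limitin_Fdist_topologyI[of 7])
  let ?E = "\<lambda>w \<alpha>. (cBrownian w \<alpha> - cBrownian z \<alpha>) / (w - z) - cWhite_noise z \<alpha>"
  \<comment> \<open>Within distance 1 of z both points lie in the disc of radius |z| + 1; the second
    + 1 comes from the Cauchy estimate for the derivatives.\<close>
  define K where "K = exp (4 * (cmod z + 1 + 1)\<^sup>2 + 2)"
  have "eventually (\<lambda>w. w \<in> ball z 1 \<and> w \<noteq> z) (at z)"
    using eventually_at_in_open[of "ball z 1" z] by simp
  then have near: "eventually (\<lambda>w. ?E w \<in> Fneg 7 \<and> norm_neg 7 (?E w) \<le> K * cmod (w - z)) (at z)"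
  proof eventually_elim
    case (elim w)
    then have "cmod w \<le> cmod z + 1"
      using norm_triangle_ineq2[of w z] by (simp add: dist_norm norm_minus_commute)
    then show ?case
      using cBrownian_diff_quotient_bound[of w z "cmod z + 1"] elim by (simp add: K_def)
  qed
  then show "eventually (\<lambda>w. ?E w \<in> Fneg 7) (at z)"
    by (rule eventually_mono) simp
  show "((\<lambda>w. norm_neg 7 (?E w)) \<longlongrightarrow> 0) (at z)"
  proof (rule tendsto_sandwich[of "\<lambda>_. 0" _ _ "\<lambda>w. K * cmod (w - z)"])
    show "eventually (\<lambda>w. 0 \<le> norm_neg 7 (?E w)) (at z)"
      unfolding norm_neg_def using weight_ge_1
      by (intro always_eventually allI real_sqrt_ge_zero infsum_nonneg divide_nonneg_nonneg
          zero_le_power) (auto intro: order_trans[OF zero_le_one])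
    show "eventually (\<lambda>w. norm_neg 7 (?E w) \<le> K * cmod (w - z)) (at z)"
      using near by (rule eventually_mono) simp
    show "((\<lambda>w. K * cmod (w - z)) \<longlongrightarrow> 0) (at z)"
      by (auto intro!: tendsto_eq_intros)
  qed simp
qed (simp_all add: cWhite_noise_Fneg)

theorem theorem6p1:
  fixes R :: real
  assumes "R > 0"
  shows "(\<exists>p\<ge>1. \<forall>z. cmod z \<le> R \<longrightarrow> cWhite_noise z \<in> Fneg p)
    \<and> (\<forall>z. cmod z \<le> R \<longrightarrow>
         cWhite_noise z \<in> Fdist \<and>
         limitin Fdist_topology
           (\<lambda>w \<alpha>. (cBrownian w \<alpha> - cBrownian z \<alpha>) / (w - z)) (cWhite_noise z) (at z))"
proof (intro conjI allI impI)
  show "\<exists>p\<ge>1. \<forall>z. cmod z \<le> R \<longrightarrow> cWhite_noise z \<in> Fneg p"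
    using cWhite_noise_Fneg by (intro exI[of _ 7]) simp
  show "cWhite_noise z \<in> Fdist" for z
    using cWhite_noise_Fneg[of z] unfolding Fdist_def by (intro UN_I[of 7]) auto
qed (rule cBrownian_has_derivative)

end
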